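(* For all integers $n,k\geq 0$, \begin{align*} c_{11,3}\left(2^{3k+5}n+\frac{3\cdot 2^{3k+3}+4}{7}\right)&\equiv 0\pmod 2,\\ c_{11,3}\left(2^{3k+6}n+\frac{19\cdot 2^{3k+4}+4}{7}\right)&\equiv 0\pmod 2,\\ c_{11,3}\left(2^{3k+7}n+\frac{27\cdot 2^{3k+5}+4}{7}\right)&\equiv 0\pmod 2. \end{align*}
   Context: For complex $a,b$ the false theta function is $\Psi(a,b):=\sum_{n=0}^\infty a^{n(n+1)/2}b^{n(n-1)/2}-\sum_{n=-\infty}^{-1}a^{n(n+1)/2}b^{n(n-1)/2}$. For positive integers $r,s$, the integers $c_{r,s}(n)$ ($n\ge 0$) are defined by the power series identity $\sum_{n=0}^\infty c_{r,s}(n)q^n=\dfrac{1}{\Psi(-q^r,q^s)}$ (the denominator is a power series in $q$ with constant term $1$). *)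

theory Defs
  imports "HOL-Analysis.Analysis" "HOL-Computational_Algebra.Formal_Power_Series"
    "HOL-Number_Theory.Cong"
begin

text \<open>
  The defining series makes sense in any topological commutative ring: for complex \<open>a\<close>, \<open>b\<close> it is
  the usual false theta function, and for formal power series (with their library metric, in which
  convergence means that every coefficient is eventually constant) it is the expansion in \<open>q\<close>.
  The exponents \<open>n (n + 1) / 2\<close> and \<open>n (n - 1) / 2\<close> are non-negative integers for every integer \<open>n\<close>,
  so neither \<open>div\<close> nor \<open>nat\<close> loses information.
\<close>

definition false_theta :: "'a \<Rightarrow> 'a \<Rightarrow> 'a :: {comm_ring_1, t2_space}" where
  "false_theta a b =
     (\<Sum>\<^sub>\<infinity>n\<in>{0::int..}. a ^ nat (n * (n + 1) div 2) * b ^ nat (n * (n - 1) div 2)) -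
     (\<Sum>\<^sub>\<infinity>n\<in>{..-1::int}. a ^ nat (n * (n + 1) div 2) * b ^ nat (n * (n - 1) div 2))"

text \<open>
  The indeterminate \<open>q\<close> is \<^const>\<open>fps_X\<close>. As \<^typ>\<open>int\<close> is not a field, the reciprocal is taken
  with \<^const>\<open>fps_right_inverse\<close>, whose second argument is the inverse of the constant term, here \<open>1\<close>;
  see \<open>c_generating_function\<close> below.
\<close>

definition c :: "nat \<Rightarrow> nat \<Rightarrow> nat \<Rightarrow> int" where
  "c r s n = fps_nth (fps_right_inverse (false_theta (- (fps_X ^ r)) (fps_X ^ s) :: int fps) 1) n"

lemma has_sum_fpsI:
  fixes f :: "'i \<Rightarrow> 'a::comm_ring_1 fps"
  assumes fin: "\<And>k. finite {i \<in> A. fps_nth (f i) k \<noteq> 0}"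
  shows "(f has_sum Abs_fps (\<lambda>k. \<Sum>i | i \<in> A \<and> fps_nth (f i) k \<noteq> 0. fps_nth (f i) k)) A"
  unfolding has_sum_def
proof (rule tendsto_fpsI)
  fix k
  have "\<forall>\<^sub>F S in finite_subsets_at_top A. finite S \<and> {i \<in> A. fps_nth (f i) k \<noteq> 0} \<subseteq> S \<and> S \<subseteq> A"
    unfolding eventually_finite_subsets_at_top
    by (intro exI [of _ "{i \<in> A. fps_nth (f i) k \<noteq> 0}"] conjI allI impI fin) auto
  then show "\<forall>\<^sub>F S in finite_subsets_at_top A. fps_nth (sum f S) k =
      fps_nth (Abs_fps (\<lambda>k. \<Sum>i | i \<in> A \<and> fps_nth (f i) k \<noteq> 0. fps_nth (f i) k)) k"
  proof eventually_elim
    case (elim S)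
    then have "(\<Sum>i\<in>S. fps_nth (f i) k) = (\<Sum>i | i \<in> A \<and> fps_nth (f i) k \<noteq> 0. fps_nth (f i) k)"
      by (intro sum.mono_neutral_right) auto
    then show ?case by (simp add: fps_sum_nth)
  qed
qed

lemma false_theta_term_nth:
  "fps_nth ((- (fps_X ^ r)) ^ i * (fps_X ^ s) ^ j :: int fps) k =
     (if k = r * i + s * j then (-1) ^ i else 0)"
proof -
  have "(- (fps_X ^ r)) ^ i * (fps_X ^ s) ^ j = (-1) ^ i * (fps_X ^ (r * i + s * j) :: int fps)"
    by (simp add: power_minus [of "fps_X ^ r"] power_mult power_add mult.assoc)
  also have "(-1) ^ i = (fps_const ((-1) ^ i) :: int fps)"
    by (cases "even i") (simp_all flip: fps_const_neg)
  finally have eq: "(- (fps_X ^ r)) ^ i * (fps_X ^ s) ^ j =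
      fps_const ((-1) ^ i) * (fps_X ^ (r * i + s * j) :: int fps)" .
  show ?thesis unfolding eq fps_mult_left_const_nth fps_X_power_nth by simp
qed

lemma exponents_eq:
  fixes n :: int
  shows "int (nat (n * (n + 1) div 2)) = n * (n + 1) div 2"
    and "int (nat (n * (n - 1) div 2)) = n * (n - 1) div 2"
    and "n * (n + 1) div 2 + n * (n - 1) div 2 = n * n"
proof -
  have "2 dvd n * (n + 1)" "2 dvd n * (n - 1)" by auto
  then have "2 * (n * (n + 1) div 2) + 2 * (n * (n - 1) div 2) = n * (n + 1) + n * (n - 1)"
    by simp
  then show "n * (n + 1) div 2 + n * (n - 1) div 2 = n * n" by (simp only: distrib_left right_diff_distrib)
  have "0 \<le> n * (n + 1)" "0 \<le> n * (n - 1)"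
    by (auto simp: zero_le_mult_iff)
  then show "int (nat (n * (n + 1) div 2)) = n * (n + 1) div 2"
    and "int (nat (n * (n - 1) div 2)) = n * (n - 1) div 2"
    by simp_all
qed

lemma abs_le_exponent:
  fixes n :: int
  assumes "r > 0" "s > 0"
  shows "\<bar>n\<bar> \<le> int (r * nat (n * (n + 1) div 2) + s * nat (n * (n - 1) div 2))"
proof -
  have "\<bar>n\<bar> \<le> \<bar>n\<bar> * \<bar>n\<bar>"
    using mult_right_mono [of 1 "\<bar>n\<bar>" "\<bar>n\<bar>"] by (cases "n = 0") auto
  then have "\<bar>n\<bar> \<le> int (nat (n * (n + 1) div 2) + nat (n * (n - 1) div 2))"
    unfolding of_nat_add exponents_eq abs_mult_self_eq .
  also have "\<dots> \<le> int (r * nat (n * (n + 1) div 2) + s * nat (n * (n - 1) div 2))"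
    using assms by (intro of_nat_mono add_mono) auto
  finally show ?thesis .
qed

lemma false_theta_has_sum:
  fixes A :: "int set"
  assumes "r > 0" "s > 0"
  defines "f \<equiv> \<lambda>n::int. (- (fps_X ^ r)) ^ nat (n * (n + 1) div 2) *
                          (fps_X ^ s) ^ nat (n * (n - 1) div 2) :: int fps"
  shows "(f has_sum Abs_fps (\<lambda>k. \<Sum>n | n \<in> A \<and> fps_nth (f n) k \<noteq> 0. fps_nth (f n) k)) A"
proof (rule has_sum_fpsI)
  fix k
  have "{n \<in> A. fps_nth (f n) k \<noteq> 0} \<subseteq> {- int k..int k}"
    using abs_le_exponent [OF assms(1,2)]
    by (fastforce simp: f_def false_theta_term_nth abs_le_iff minus_le_iff simp del: of_nat_add of_nat_mult split: if_splits)
  then show "finite {n \<in> A. fps_nth (f n) k \<noteq> 0}"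
    by (rule finite_subset) simp
qed

lemma false_theta_nth_0:
  assumes "r > 0" "s > 0"
  shows "fps_nth (false_theta (- (fps_X ^ r)) (fps_X ^ s) :: int fps) 0 = 1"
proof -
  define f :: "int \<Rightarrow> int fps" where "f = (\<lambda>n. (- (fps_X ^ r)) ^ nat (n * (n + 1) div 2) *
                                         (fps_X ^ s) ^ nat (n * (n - 1) div 2))"
  have f_0: "fps_nth (f n) 0 = (if n = 0 then 1 else 0)" for n
  proof (cases "n = 0")
    case False
    then have "r * nat (n * (n + 1) div 2) + s * nat (n * (n - 1) div 2) \<noteq> 0"
      using abs_le_exponent [OF assms, of n] by linarith
    then show ?thesis using False unfolding f_def false_theta_term_nth by argo
  qed (simp add: f_def)
  have nth_0: "fps_nth (infsum f A) 0 = (\<Sum>n | n \<in> A \<and> n = 0. 1)" for A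
  proof -
    have "(f has_sum Abs_fps (\<lambda>k. \<Sum>n | n \<in> A \<and> fps_nth (f n) k \<noteq> 0. fps_nth (f n) k)) A"
      unfolding f_def by (rule false_theta_has_sum [OF assms])
    then have "fps_nth (infsum f A) 0 = (\<Sum>n | n \<in> A \<and> fps_nth (f n) 0 \<noteq> 0. fps_nth (f n) 0)"
      by (simp only: infsumI fps_nth_Abs_fps)
    also have "\<dots> = (\<Sum>n | n \<in> A \<and> n = 0. 1)"
      by (intro sum.cong) (auto simp: f_0)
    finally show ?thesis .
  qed
  have "{n. n \<in> {0::int..} \<and> n = 0} = {0}" "{n. n \<in> {..-1::int} \<and> n = 0} = {}" by auto
  with nth_0 [of "{0..}"] nth_0 [of "{..-1}"]
  have "fps_nth (infsum f {0..}) 0 = 1" "fps_nth (infsum f {..-1}) 0 = 0"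
    by simp_all
  then show ?thesis
    unfolding false_theta_def f_def by simp
qed

theorem c_generating_function:
  assumes "r > 0" "s > 0"
  shows "Abs_fps (c r s) * false_theta (- (fps_X ^ r)) (fps_X ^ s) = 1"
proof -
  have "Abs_fps (c r s) = fps_right_inverse (false_theta (- (fps_X ^ r)) (fps_X ^ s)) 1"
    by (rule fps_ext) (simp add: c_def)
  then show ?thesis
    by (simp add: mult.commute fps_right_inverse false_theta_nth_0 [OF assms])
qed

end

theory Submission
  imports Defs "HOL-Library.Z2" "HOL-Computational_Algebra.Formal_Laurent_Series"
begin

text \<open>
  Write \<open>\<theta>\<^sub>r\<close> for the sum of \<open>q ^ (m\<^sup>2)\<close> over all integers \<open>m\<close> congruent to \<open>r\<close> modulo 7. Modulo 2 the signs in
  the false theta function are irrelevant, and \<open>7 (7 n\<^sup>2 + 4 n) + 4 = (7 n + 2)\<^sup>2\<close> turns its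
  reciprocal into \<open>1 / \<theta>\<^sub>2\<close>, where \<open>c 11 3 N\<close> is the coefficient of \<open>q ^ (7 N - 4)\<close>.
  Let \<open>U\<close> extract the coefficients of even index. In characteristic 2 we have
  \<open>U (F G\<^sup>2) = U F \<cdot> G\<close>; moreover \<open>U \<theta>\<^sub>2 = \<theta>\<^sub>1\<^sup>2\<close>, and the substitution \<open>x = s + t\<close>, \<open>y = s - t\<close> in
  \<open>x\<^sup>2 + y\<^sup>2\<close> gives \<open>U (\<theta>\<^sub>2 \<theta>\<^sub>1) = \<theta>\<^sub>2 \<theta>\<^sub>3\<close>. Hence \<open>U (1 / \<theta>\<^sub>2) = \<theta>\<^sub>1\<^sup>2 / \<theta>\<^sub>2\<close>, then
  \<open>U\<^sup>2 (1 / \<theta>\<^sub>2) = \<theta>\<^sub>1\<^sup>3 / \<theta>\<^sub>2\<close> and \<open>U\<^sup>3 (1 / \<theta>\<^sub>2) = \<theta>\<^sub>1 \<theta>\<^sub>3\<close>. The three progressions lie in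
  \<open>7 N - 4 = 8 \<cdot> 2 ^ j u\<close> with \<open>u\<close> congruent to 3 modulo 4, and \<open>2 ^ j u\<close> is not a sum of two squares.
\<close>

section \<open>Power series over the field with two elements\<close>

declare add_bit_eq_xor [simp del] mult_bit_eq_and [simp del]

lemma bit_add_self: "a + a = (0 :: bit)"
  by (cases a) (simp_all add: mult_2 [symmetric])

lemma of_int_bit_eq_0_iff: "of_int z = (0 :: bit) \<longleftrightarrow> even z"
  by (cases "even z") (auto elim!: evenE oddE)

definition even_part :: "'a fps \<Rightarrow> 'a fps" where
  "even_part F = Abs_fps (\<lambda>n. fps_nth F (2 * n))"

lemma even_part_nth [simp]: "fps_nth (even_part F) n = fps_nth F (2 * n)"
  by (simp add: even_part_def)

lemma bit_fps_add_self: "F + F = (0 :: bit fps)"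
  by (rule fps_ext) (simp add: bit_add_self)

text \<open>Frobenius: cross terms occur in equal pairs and cancel, and constants are their own
  squares. Writing \<open>F = c + q S\<close> and squaring lowers the coefficient index by 2, which
  drives the induction.\<close>

lemma bit_fps_power2: "F\<^sup>2 = F oo (fps_X\<^sup>2 :: bit fps)"
proof (rule fps_ext)
  fix n
  show "fps_nth (F\<^sup>2) n = fps_nth (F oo fps_X\<^sup>2) n"
  proof (induction n arbitrary: F rule: less_induct)
    case (less n)
    let ?c = "fps_const (fps_nth F 0)" and ?S = "fps_shift 1 F"
    have F: "F = ?c + fps_X * ?S"
      by (rule fps_ext) (simp add: fps_X_mult_nth)
    have "F\<^sup>2 = ?c\<^sup>2 + (?c * fps_X * ?S + ?c * fps_X * ?S) + fps_X\<^sup>2 * ?S\<^sup>2"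
      by (subst F) (simp add: power2_eq_square algebra_simps del: fps_shift_one)
    then have sq: "F\<^sup>2 = ?c\<^sup>2 + fps_X\<^sup>2 * ?S\<^sup>2"
      by (simp only: bit_fps_add_self add_0_right)
    show ?case
    proof (cases "n < 2")
      case True
      then consider "n = 0" | "n = 1" by linarith
      then show ?thesis
        by cases (simp_all only: sq fps_nth_compose_X_power,
            simp_all add: fps_X_power_mult_nth power2_eq_square, metis bit.exhaust)
    next
      case False
      then obtain m where n: "n = m + 2"
        by (metis add.commute le_Suc_ex not_less)
      have "fps_nth (F\<^sup>2) n = fps_nth (?S\<^sup>2) m"
        unfolding sq by (simp add: n fps_X_power_mult_nth power2_eq_square [of ?c])
      also have "\<dots> = fps_nth (?S oo fps_X\<^sup>2) m"
        by (rule less.IH) (simp add: n)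
      also have "\<dots> = fps_nth (F oo fps_X\<^sup>2) n"
        by (auto simp: fps_nth_compose_X_power n)
      finally show ?thesis .
    qed
  qed
qed

text \<open>By Frobenius \<open>G\<^sup>2\<close> is \<open>G\<close> evaluated at
  \<open>q\<^sup>2\<close>, so an even coefficient of the product uses only even coefficients of
  \<open>F\<close>.\<close>

lemma even_part_mult_square: "even_part (F * G\<^sup>2) = even_part F * (G :: bit fps)"
proof (rule fps_ext)
  fix n
  have "fps_nth (even_part (F * G\<^sup>2)) n = fps_nth ((G oo fps_X\<^sup>2) * F) (2 * n)"
    by (simp only: even_part_nth bit_fps_power2 [of G] mult.commute [of F])
  also have "\<dots> = (\<Sum>i=0..2*n. fps_nth (G oo fps_X\<^sup>2) i * fps_nth F (2 * n - i))"
    by (simp add: fps_mult_nth)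
  also have "\<dots> = (\<Sum>i\<in>(\<lambda>j. 2 * j) ` {0..n}. fps_nth (G oo fps_X\<^sup>2) i * fps_nth F (2 * n - i))"
  proof (rule sum.mono_neutral_right)
    show "\<forall>i\<in>{0..2*n} - (\<lambda>j. 2 * j) ` {0..n}. fps_nth (G oo fps_X\<^sup>2) i * fps_nth F (2 * n - i) = 0"
    proof
      fix i assume "i \<in> {0..2*n} - (\<lambda>j. 2 * j) ` {0..n}"
      then have "odd i" by (auto elim!: evenE)
      then show "fps_nth (G oo fps_X\<^sup>2) i * fps_nth F (2 * n - i) = 0"
        by (simp add: fps_nth_compose_X_power)
    qed
  qed auto
  also have "\<dots> = (\<Sum>j=0..n. fps_nth G j * fps_nth F (2 * (n - j)))"
    by (subst sum.reindex)
      (simp_all add: inj_on_def fps_nth_compose_X_power flip: diff_mult_distrib2)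
  also have "\<dots> = fps_nth (even_part F * G) n"
    by (simp add: fps_mult_nth mult.commute [of "even_part F"])
  finally show "fps_nth (even_part (F * G\<^sup>2)) n = fps_nth (even_part F * G) n" .
qed

section \<open>Theta series of residue classes modulo 7\<close>

text \<open>Counting representations coefficientwise turns identities between theta series into
  bijections of finite sets.\<close>

definition theta7 :: "int \<Rightarrow> bit fps" where
  "theta7 r = Abs_fps (\<lambda>n. of_nat (card {m::int. [m = r] (mod 7) \<and> m\<^sup>2 = int n}))"

lemma finite_square_eq: "finite {m::int. P m \<and> m\<^sup>2 = int n}"
proof (rule finite_subset)
  show "{m::int. P m \<and> m\<^sup>2 = int n} \<subseteq> {- int n..int n}"
  proof clarify
    fix m :: int assume "m\<^sup>2 = int n"
    moreover have "\<bar>m\<bar> \<le> m\<^sup>2"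
      using self_le_power [of "\<bar>m\<bar>" 2] by (cases "m = 0") auto
    ultimately show "m \<in> {- int n..int n}" by auto
  qed
qed simp

lemma theta7_mult_nth:
  "fps_nth (theta7 r * theta7 s) n =
     of_nat (card {(x, y). [x = r] (mod 7) \<and> [y = s] (mod 7) \<and> x\<^sup>2 + y\<^sup>2 = int n})"
proof -
  let ?S = "\<lambda>r i. {m::int. [m = r] (mod 7) \<and> m\<^sup>2 = int i}"
  have eq: "{(x, y). [x = r] (mod 7) \<and> [y = s] (mod 7) \<and> x\<^sup>2 + y\<^sup>2 = int n} =
      (\<Union>i\<in>{0..n}. ?S r i \<times> ?S s (n - i))" (is "?L = ?R")
  proof (intro equalityI subsetI)
    fix p assume "p \<in> ?L"
    then obtain x y where p: "p = (x, y)" "[x = r] (mod 7)" "[y = s] (mod 7)" "x\<^sup>2 + y\<^sup>2 = int n"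
      by auto
    have "nat (x\<^sup>2) \<in> {0..n}" "x\<^sup>2 = int (nat (x\<^sup>2))" "y\<^sup>2 = int (n - nat (x\<^sup>2))"
      using zero_le_power2 [of x] zero_le_power2 [of y] p(4)
      unfolding atLeastAtMost_iff by linarith+
    with p show "p \<in> ?R" by blast
  qed (auto simp: of_nat_diff)
  have "card ?L = (\<Sum>i=0..n. card (?S r i) * card (?S s (n - i)))"
    unfolding eq
    by (subst card_UN_disjoint) (auto simp: card_cartesian_product simp del: of_nat_diff
        intro!: finite_cartesian_product finite_square_eq)
  then show ?thesis
    by (simp add: fps_mult_nth theta7_def)
qed

text \<open>An even \<open>m\<^sup>2\<close> forces \<open>m = 2 k\<close>, and \<open>2 k\<close>
  lies in class 2 exactly when \<open>k\<close> lies in class 1. Then \<open>m\<^sup>2 = 2 n\<close>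
  reads \<open>2 k\<^sup>2 = n\<close>, so what remains is \<open>theta7 1\<close> at
  \<open>q\<^sup>2\<close>, its square by Frobenius.\<close>

lemma even_part_theta7: "even_part (theta7 2) = (theta7 1)\<^sup>2"
proof (rule fps_ext)
  fix n
  have dbl: "[2 * m = 2] (mod 7) \<longleftrightarrow> [m = 1] (mod 7)" for m :: int
    unfolding cong_iff_dvd_diff by presburger
  have eq: "{m::int. [m = 2] (mod 7) \<and> m\<^sup>2 = int (2 * n)} =
      (\<lambda>m. 2 * m) ` {m::int. [m = 1] (mod 7) \<and> 2 * m\<^sup>2 = int n}" (is "?L = ?f ` ?R")
  proof (intro equalityI subsetI)
    fix m assume m: "m \<in> ?L"
    then have "even (m\<^sup>2)" by simp
    then obtain k where "m = 2 * k" by auto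
    then show "m \<in> ?f ` ?R" using m dbl by (auto simp: power2_eq_square)
  qed (auto simp: dbl power2_eq_square)
  have "card ?L = card ?R"
    unfolding eq by (rule card_image) (auto simp: inj_on_def)
  moreover have "?R = (if even n then {m::int. [m = 1] (mod 7) \<and> m\<^sup>2 = int (n div 2)} else {})"
  proof (cases "even n")
    case True
    then obtain k where "n = 2 * k" ..
    then show ?thesis by simp
  next
    case False
    then have "2 * m\<^sup>2 \<noteq> int n" for m
      by (metis dvd_triv_left even_of_nat)
    with False show ?thesis by simp
  qed
  moreover have "fps_nth (even_part (theta7 2)) n = of_nat (card ?L)"
    by (simp only: even_part_nth theta7_def fps_nth_Abs_fps)
  ultimately have "fps_nth (even_part (theta7 2)) n = of_nat (card
      (if even n then {m::int. [m = 1] (mod 7) \<and> m\<^sup>2 = int (n div 2)} else {}))"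
    by (simp only:)
  also have "\<dots> = fps_nth ((theta7 1)\<^sup>2) n"
    unfolding bit_fps_power2 [of "theta7 1"] fps_nth_compose_X_power by (simp add: theta7_def)
  finally show "fps_nth (even_part (theta7 2)) n = fps_nth ((theta7 1)\<^sup>2) n" .
qed

text \<open>Both summands have the same parity, so half their sum and half their difference are
  integers.\<close>

lemma sum_squares_half:
  fixes x y :: int
  assumes "x\<^sup>2 + y\<^sup>2 = 2 * n"
  obtains s t where "x = s + t" "y = s - t" "s\<^sup>2 + t\<^sup>2 = n"
proof -
  have "even (x\<^sup>2 + y\<^sup>2)" using assms by simp
  then have "even (x + y)" by auto
  then obtain s where s: "x + y = 2 * s" ..
  let ?t = "x - s"
  have y: "y = s - ?t" using s by simp
  have "2 * (s\<^sup>2 + ?t\<^sup>2) = x\<^sup>2 + y\<^sup>2"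
    unfolding y by (simp add: power2_eq_square algebra_simps)
  then show ?thesis using that [of s ?t] y assms by simp
qed

lemma even_part_theta7_mult: "even_part (theta7 2 * theta7 1) = theta7 2 * theta7 3"
proof (rule fps_ext)
  fix n
  let ?L = "{(x::int, y). [x = 2] (mod 7) \<and> [y = 1] (mod 7) \<and> x\<^sup>2 + y\<^sup>2 = int (2 * n)}"
  let ?R = "{(s::int, t). [s = 2] (mod 7) \<and> [t = 3] (mod 7) \<and> s\<^sup>2 + t\<^sup>2 = int n}"
  \<comment> \<open>Solving s + t = 2 and s - t = 1 modulo 7 gives s = 5 and t = 4; flipping both
    signs yields the classes 2 and 3.\<close>
  let ?f = "\<lambda>(s, t). (- s - t, t - s) :: int \<times> int"
  have cong: "[- s - t = 2] (mod 7) \<and> [t - s = 1] (mod 7) \<longleftrightarrow> [s = 2] (mod 7) \<and> [t = 3] (mod 7)"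
    for s t :: int
  proof -
    have "7 dvd s - 2 \<and> 7 dvd t - 3" if a: "7 dvd - s - t - 2" and b: "7 dvd t - s - 1"
    proof -
      have "7 dvd - 2 * s - 3" using dvd_add [OF a b] by simp
      then have "7 dvd s - 2" by presburger
      with dvd_add [OF b this] show ?thesis by simp
    qed
    moreover have "7 dvd - s - t - 2 \<and> 7 dvd t - s - 1" if a: "7 dvd s - 2" and b: "7 dvd t - 3"
    proof -
      have "- s - t - 2 = - (s - 2) - (t - 3) - 7" "t - s - 1 = (t - 3) - (s - 2)" by simp_all
      with a b show ?thesis by (metis dvd_diff dvd_minus_iff dvd_refl)
    qed
    ultimately show ?thesis unfolding cong_iff_dvd_diff by blast
  qed
  have "?L = ?f ` ?R"
  proof (intro equalityI subsetI)
    fix p assume p: "p \<in> ?L"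
    then obtain x y where xy: "p = (x, y)" "x\<^sup>2 + y\<^sup>2 = 2 * int n" by auto
    from xy(2) obtain s t where "x = s + t" "y = s - t" "s\<^sup>2 + t\<^sup>2 = int n"
      by (rule sum_squares_half)
    then show "p \<in> ?f ` ?R"
      using p xy cong [of "- s" "- t"] by (intro image_eqI [of _ _ "(- s, - t)"]) auto
  next
    fix p assume "p \<in> ?f ` ?R"
    then show "p \<in> ?L" using cong by (auto simp: power2_eq_square algebra_simps)
  qed
  moreover have "inj_on ?f ?R" by (auto simp: inj_on_def)
  ultimately have "card ?L = card ?R" by (simp add: card_image)
  then show "fps_nth (even_part (theta7 2 * theta7 1)) n = fps_nth (theta7 2 * theta7 3) n"
    by (simp add: theta7_mult_nth)
qed

section \<open>Sums of two squares and the thrice halved reciprocal\<close>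

lemma even_part_X_power_mult: "even_part (fps_X ^ (2 * k) * F) = fps_X ^ k * even_part F"
  by (rule fps_ext) (simp add: fps_X_power_mult_nth flip: diff_mult_distrib2)

text \<open>Squares are 0 or 1 modulo 4, which settles \<open>j = 0\<close>; halving a sum of two
  squares gives another one, so factors of 2 can be stripped.\<close>

lemma sum_squares_neq:
  fixes x y :: int
  assumes "u mod 4 = 3"
  shows "x\<^sup>2 + y\<^sup>2 \<noteq> 2 ^ j * u"
proof (induction j arbitrary: x y)
  case 0
  have "a\<^sup>2 mod 4 = 0 \<or> a\<^sup>2 mod 4 = 1" for a :: int
  proof -
    have "a mod 4 \<in> {0, 1, 2, 3}" by auto
    moreover have "a\<^sup>2 mod 4 = (a mod 4)\<^sup>2 mod 4" by (simp only: power_mod)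
    ultimately show ?thesis by auto
  qed
  from this [of x] this [of y] have "(x\<^sup>2 + y\<^sup>2) mod 4 \<noteq> 3" by presburger
  with assms show ?case by auto
next
  case (Suc j)
  show ?case
  proof
    assume "x\<^sup>2 + y\<^sup>2 = 2 ^ Suc j * u"
    then have "x\<^sup>2 + y\<^sup>2 = 2 * (2 ^ j * u)" by simp
    then obtain s t where "s\<^sup>2 + t\<^sup>2 = 2 ^ j * u" by (rule sum_squares_half)
    with Suc.IH show False by blast
  qed
qed

text \<open>
  \<open>E\<close> stands for \<open>q ^ 8 / \<theta>\<^sub>2\<close>; the shift by \<open>q ^ 8\<close> keeps everything a power series and becomes
  a shift by \<open>q\<close> after three halvings.
\<close>
lemma even_part_reciprocal:
  assumes "E * theta7 2 = fps_X ^ 8"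
  shows "even_part (even_part (even_part E)) = fps_X * (theta7 1 * theta7 3)"
proof -
  let ?A = "theta7 2" and ?B = "theta7 1" and ?C = "theta7 3"
  have "?A \<noteq> 0" using assms by auto
  \<comment> \<open>Each halving first multiplies by \<open>?A\<close>: the square on the left
    leaves \<open>even_part\<close> as a single \<open>?A\<close>, while the right side becomes an
    even power of \<open>fps_X\<close> times a series whose even part is known.\<close>
  have "E * ?A\<^sup>2 = fps_X ^ (2 * 4) * ?A"
    using assms by (simp add: power2_eq_square flip: mult.assoc)
  then have 1: "even_part E * ?A = fps_X ^ 4 * ?B\<^sup>2"
    by (metis even_part_mult_square even_part_X_power_mult even_part_theta7)
  then have "even_part E * ?A\<^sup>2 = fps_X ^ (2 * 2) * (?A * ?B\<^sup>2)"
    by (simp add: power2_eq_square flip: mult.assoc)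
  then have 2: "even_part (even_part E) * ?A = fps_X ^ 2 * (?B\<^sup>2 * ?B)"
    by (metis even_part_mult_square even_part_X_power_mult even_part_theta7)
  then have "even_part (even_part E) * ?A\<^sup>2 = fps_X ^ (2 * 1) * (?A * ?B * ?B\<^sup>2)"
    by (simp add: power2_eq_square flip: mult.assoc)
  then have "even_part (even_part (even_part E)) * ?A = fps_X ^ 1 * (?A * ?C * ?B)"
    by (metis even_part_mult_square even_part_X_power_mult even_part_theta7_mult)
  then have "even_part (even_part (even_part E)) * ?A = fps_X * (?B * ?C) * ?A"
    by (simp add: mult_ac)
  with \<open>?A \<noteq> 0\<close> show ?thesis by (metis mult_right_cancel)
qed

section \<open>The false theta function modulo 2\<close>

lemma false_theta_mod_2:
  "of_int (fps_nth (false_theta (- (fps_X ^ 11)) (fps_X ^ 3)) k) = fps_nth (theta7 2) (7 * k + 4)"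
proof -
  define f :: "int \<Rightarrow> int fps" where "f = (\<lambda>n. (- (fps_X ^ 11)) ^ nat (n * (n + 1) div 2) *
                                         (fps_X ^ 3) ^ nat (n * (n - 1) div 2))"
  have exponent: "k = 11 * nat (n * (n + 1) div 2) + 3 * nat (n * (n - 1) div 2) \<longleftrightarrow>
      (7 * n + 2)\<^sup>2 = int (7 * k + 4)" for n
  proof -
    have "even (n * (n + 1))" by simp
    then have 1: "2 * (n * (n + 1) div 2) = n * (n + 1)" by simp
    have "k = 11 * nat (n * (n + 1) div 2) + 3 * nat (n * (n - 1) div 2) \<longleftrightarrow>
        int k = 11 * (n * (n + 1) div 2) + 3 * (n * (n - 1) div 2)"
      using exponents_eq(1,2) [of n] by linarith
    also have "\<dots> \<longleftrightarrow> (7 * n + 2)\<^sup>2 = int (7 * k + 4)"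
      using 1 exponents_eq(3) [of n] by (simp add: power2_eq_square algebra_simps) linarith
    finally show ?thesis .
  qed
  let ?N = "\<lambda>A. {n \<in> A. (7 * n + 2)\<^sup>2 = int (7 * k + 4)}"
  have fin: "finite (?N A)" for A
  proof (rule finite_subset)
    show "?N A \<subseteq> (\<lambda>n. 7 * n + 2) -` {m. True \<and> m\<^sup>2 = int (7 * k + 4)}" by auto
    show "finite ((\<lambda>n. 7 * n + 2) -` {m. True \<and> m\<^sup>2 = int (7 * k + 4)})"
      by (intro finite_vimageI finite_square_eq) (auto simp: inj_def)
  qed
  \<comment> \<open>Every sign is 1 in \<open>bit\<close>, so a coefficient just counts the indices
    contributing to it.\<close>
  have coeff: "of_int (fps_nth (infsum f A) k) = (of_nat (card (?N A)) :: bit)" for A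
  proof -
    have fk: "fps_nth (f n) k = (if (7 * n + 2)\<^sup>2 = int (7 * k + 4)
        then (- 1) ^ nat (n * (n + 1) div 2) else 0)" for n
      unfolding f_def false_theta_term_nth exponent ..
    have "(f has_sum Abs_fps (\<lambda>k. \<Sum>n | n \<in> A \<and> fps_nth (f n) k \<noteq> 0. fps_nth (f n) k)) A"
      unfolding f_def by (rule false_theta_has_sum) simp_all
    then have "fps_nth (infsum f A) k = (\<Sum>n | n \<in> A \<and> fps_nth (f n) k \<noteq> 0. fps_nth (f n) k)"
      by (simp only: infsumI fps_nth_Abs_fps)
    also have "\<dots> = (\<Sum>n\<in>?N A. (- 1) ^ nat (n * (n + 1) div 2))"
      by (intro sum.cong) (auto simp: fk)
    finally show ?thesis by simp
  qed
  \<comment> \<open>Subtraction is addition in \<open>bit\<close>, so the two half-line counts merge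
    into one over all integers, which \<open>7 * n + 2\<close> carries onto the class of 2.\<close>
  have "of_int (fps_nth (false_theta (- (fps_X ^ 11)) (fps_X ^ 3)) k) =
      (of_nat (card (?N {0..})) + of_nat (card (?N {..-1})) :: bit)"
    by (simp add: false_theta_def coeff flip: f_def)
  also have "\<dots> = of_nat (card (?N {0..} \<union> ?N {..-1}))"
  proof -
    have "{0..} \<inter> {..-1} = ({} :: int set)" by auto
    then have "?N {0..} \<inter> ?N {..-1} = {}" by blast
    from card_Un_disjoint [OF fin fin this] show ?thesis
      by (simp only: of_nat_add [where 'a = bit])
  qed
  also have "?N {0..} \<union> ?N {..-1} = ?N UNIV"
  proof -
    have "{0..} \<union> {..-1} = (UNIV :: int set)" by auto
    then show ?thesis by blast
  qed
  also have "card (?N UNIV) = card ((\<lambda>n. 7 * n + 2) ` ?N UNIV)"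
    by (rule card_image [symmetric]) (simp add: inj_on_def)
  also have "(\<lambda>n. 7 * n + 2) ` ?N UNIV = {m. [m = 2] (mod 7) \<and> m\<^sup>2 = int (7 * k + 4)}"
  proof -
    have "m \<in> range (\<lambda>n. 7 * n + 2) \<longleftrightarrow> [m = 2] (mod 7)" for m :: int
      unfolding cong_iff_dvd_diff image_iff by simp presburger
    then have "range (\<lambda>n. 7 * n + 2) \<inter> {m. m\<^sup>2 = int (7 * k + 4)} =
        {m. [m = 2] (mod 7) \<and> m\<^sup>2 = int (7 * k + 4)}"
      by (simp only: set_eq_iff Int_iff mem_Collect_eq simp_thms)
    moreover have "(\<lambda>n. 7 * n + 2) ` ?N UNIV =
        range (\<lambda>n. 7 * n + 2) \<inter> {m. m\<^sup>2 = int (7 * k + 4)}" by blast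
    ultimately show ?thesis by (rule trans [rotated])
  qed
  finally show ?thesis by (simp only: theta7_def fps_nth_Abs_fps)
qed

text \<open>The square of a number in class 2 is 4 modulo 7, so only exponents
  \<open>7 * k + 4\<close> occur.\<close>

lemma theta7_2_eq:
  "theta7 2 = fps_X ^ 4 *
     (Abs_fps (\<lambda>k. of_int (fps_nth (false_theta (- (fps_X ^ 11)) (fps_X ^ 3)) k)) oo fps_X ^ 7)"
proof (rule fps_ext)
  fix n
  have mod_7: "n mod 7 = 4" if "[m = 2] (mod 7)" "m\<^sup>2 = int n" for m
  proof -
    have "[m\<^sup>2 = 2\<^sup>2] (mod 7)" using that(1) by (rule cong_pow)
    then have "int (n mod 7) = int 4" by (simp add: that(2) cong_def zmod_int)
    then show ?thesis by (simp only: of_nat_eq_iff)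
  qed
  have zero: "fps_nth (theta7 2) n = 0" if "n mod 7 \<noteq> 4"
  proof -
    have "{m. [m = 2] (mod 7) \<and> m\<^sup>2 = int n} = {}"
      using that mod_7 by blast
    then show ?thesis by (simp only: theta7_def fps_nth_Abs_fps card.empty of_nat_0)
  qed
  have dvd: "4 \<le> n \<and> 7 dvd n - 4 \<longleftrightarrow> n mod 7 = 4" by presburger
  show "fps_nth (theta7 2) n = fps_nth (fps_X ^ 4 *
     (Abs_fps (\<lambda>k. of_int (fps_nth (false_theta (- (fps_X ^ 11)) (fps_X ^ 3)) k)) oo fps_X ^ 7)) n"
  proof (cases "n mod 7 = 4")
    case True
    with dvd show ?thesis
      by (auto simp: fps_X_power_mult_nth fps_nth_compose_X_power false_theta_mod_2)
  next
    case False
    with dvd zero show ?thesis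
      by (auto simp: fps_X_power_mult_nth fps_nth_compose_X_power)
  qed
qed

section \<open>Parity along the three progressions\<close>

text \<open>The value is the coefficient of \<open>E\<close> at
  \<open>7 * N + 4 = 8 * (2 ^ j * u + 1)\<close>. Three halvings and the factor \<open>fps_X\<close>
  move it to index \<open>2 ^ j * u\<close> of \<open>theta7 1 * theta7 3\<close>, which counts sums
  of two squares.\<close>

lemma c_11_3_even:
  assumes N: "7 * N = 8 * (2 ^ j * u) + 4" and u: "u mod 4 = 3"
  shows "even (c 11 3 N)"
proof -
  let ?F = "false_theta (- (fps_X ^ 11)) (fps_X ^ 3) :: int fps"
  let ?P = "Abs_fps (\<lambda>k. of_int (c 11 3 k)) :: bit fps"
  let ?Q = "Abs_fps (\<lambda>k. of_int (fps_nth ?F k)) :: bit fps"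
  \<comment> \<open>As \<open>theta7 2\<close> is \<open>q ^ 4\<close> times \<open>?Q\<close> at
    \<open>q ^ 7\<close>, and \<open>?P\<close> inverts \<open>?Q\<close>, this is
    \<open>q ^ 8\<close> divided by \<open>theta7 2\<close>.\<close>
  define E where "E = fps_X ^ 4 * (?P oo fps_X ^ 7)"
  have "?P * ?Q = 1"
  proof (rule fps_ext)
    fix n
    have "fps_nth (?P * ?Q) n = of_int (fps_nth (Abs_fps (c 11 3) * ?F) n)"
      by (simp add: fps_mult_nth)
    then show "fps_nth (?P * ?Q) n = fps_nth 1 n"
      by (simp add: c_generating_function)
  qed
  then have "(?P oo fps_X ^ 7) * (?Q oo fps_X ^ 7) = 1"
    by (metis fps_compose_mult_distrib fps_compose_1 fps_X_power_nth zero_neq_numeral)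
  then have "E * theta7 2 = fps_X ^ 4 * fps_X ^ 4"
    unfolding E_def theta7_2_eq by (simp add: mult_ac)
  then have "even_part (even_part (even_part E)) = fps_X * (theta7 1 * theta7 3)"
    by (intro even_part_reciprocal) (simp flip: power_add)
  then have "fps_nth (even_part (even_part (even_part E))) (2 ^ j * u + 1) =
      fps_nth (theta7 1 * theta7 3) (2 ^ j * u)"
    by simp
  moreover have "2 * (2 * (2 * (2 ^ j * u + 1))) = 8 * (2 ^ j * u + 1)" by simp
  ultimately have "fps_nth E (8 * (2 ^ j * u + 1)) = fps_nth (theta7 1 * theta7 3) (2 ^ j * u)"
    by (simp only: even_part_nth)
  also have "\<dots> = 0"
  proof -
    have "int u mod 4 = 3" using u by presburger
    then have "{(x::int, y). [x = 1] (mod 7) \<and> [y = 3] (mod 7) \<and> x\<^sup>2 + y\<^sup>2 = int (2 ^ j * u)} = {}"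
      using sum_squares_neq by auto
    then show ?thesis by (simp only: theta7_mult_nth card.empty of_nat_0)
  qed
  also have "8 * (2 ^ j * u + 1) = 7 * N + 4" using N by simp
  also have "fps_nth E (7 * N + 4) = of_int (c 11 3 N)"
    by (simp add: E_def fps_X_power_mult_nth fps_nth_compose_X_power)
  finally show ?thesis by (simp add: of_int_bit_eq_0_iff)
qed

theorem theorem5p1:
  fixes n k :: nat
  shows "[c 11 3 (2 ^ (3 * k + 5) * n + (3 * 2 ^ (3 * k + 3) + 4) div 7) = 0] (mod 2) \<and>
         [c 11 3 (2 ^ (3 * k + 6) * n + (19 * 2 ^ (3 * k + 4) + 4) div 7) = 0] (mod 2) \<and>
         [c 11 3 (2 ^ (3 * k + 7) * n + (27 * 2 ^ (3 * k + 5) + 4) div 7) = 0] (mod 2)"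
proof -
  \<comment> \<open>Since 8 is 1 modulo 7, so is \<open>p\<close>, and all three divisions by 7 are
    exact. The progressions have \<open>j = 3 * k\<close>, \<open>3 * k + 1\<close>,
    \<open>3 * k + 2\<close> and \<open>u = 28 * n + 3\<close>, \<open>28 * n + 19\<close>,
    \<open>28 * n + 27\<close>.\<close>
  define p :: nat where "p = 2 ^ (3 * k)"
  have "[(2 ^ 3) ^ k = (1::nat) ^ k] (mod 7)"
    by (intro cong_pow) (simp add: cong_def)
  then have "p mod 7 = 1" by (simp add: p_def power_mult cong_def)
  then obtain t where t: "p = 7 * t + 1" by (metis mult_div_mod_eq)
  have "even (c 11 3 (32 * p * n + (3 * (8 * p) + 4) div 7))"
  proof (rule c_11_3_even)
    have "7 dvd 3 * (8 * p) + 4" by (rule dvdI [of _ _ "24 * t + 4"]) (simp add: t)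
    then show "7 * (32 * p * n + (3 * (8 * p) + 4) div 7) = 8 * (2 ^ (3 * k) * (28 * n + 3)) + 4"
      by (simp add: distrib_left flip: p_def)
  qed presburger
  moreover have "even (c 11 3 (64 * p * n + (19 * (16 * p) + 4) div 7))"
  proof (rule c_11_3_even)
    have "7 dvd 19 * (16 * p) + 4" by (rule dvdI [of _ _ "304 * t + 44"]) (simp add: t)
    then show "7 * (64 * p * n + (19 * (16 * p) + 4) div 7) = 8 * (2 ^ (3 * k + 1) * (28 * n + 19)) + 4"
      by (simp add: distrib_left flip: p_def)
  qed presburger
  moreover have "even (c 11 3 (128 * p * n + (27 * (32 * p) + 4) div 7))"
  proof (rule c_11_3_even)
    have "7 dvd 27 * (32 * p) + 4" by (rule dvdI [of _ _ "864 * t + 124"]) (simp add: t)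
    then show "7 * (128 * p * n + (27 * (32 * p) + 4) div 7) = 8 * (2 ^ (3 * k + 2) * (28 * n + 27)) + 4"
      by (simp add: distrib_left power_add flip: p_def)
  qed presburger
  moreover have "2 ^ (3 * k + 3) = 8 * p" "2 ^ (3 * k + 4) = 16 * p" "2 ^ (3 * k + 5) = 32 * p"
    "2 ^ (3 * k + 6) = 64 * p" "2 ^ (3 * k + 7) = 128 * p"
    by (simp_all add: p_def power_add)
  ultimately show ?thesis by (simp only: cong_0_iff)
qed

end
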